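(* Let $d \ge 1$ and let $C_1, C_2 \subset \mathbb{R}^d$ be compact sets satisfying $\tau(C_1)\tau(C_2) > 1$, where $\tau$ denotes thickness. Then for any $x^0 \in C_1 \times C_2 \subset \mathbb{R}^{2d}$ there exists an open neighborhood $S$ of $x^0$ such that $$\bigcap_{x \in S} \Delta_x(C_1 \times C_2)$$ has non-empty interior (in $\mathbb{R}$).
   Context: Pinned distance set: for $B \subset \mathbb{R}^{m}$ and a point $x \in \mathbb{R}^m$, $\Delta_x(B) := \{|x-y| : y \in B\}$, with $|\cdot|$ the Euclidean norm. Gaps: for a compact set $C \subset \mathbb{R}^d$, let $\{G_n\}_{n\ge 1}$ be the (at most countably many) bounded open path-connected components of the complement of $C$ (the bounded gaps), ordered by non-increasing diameter, and let $E$ be the unbounded open path-connected component of the complement of $C$ (the unbounded gap; when $d=1$, $E$ is the union of the two unbounded intervals). Thickness: if $C$ has at least one bounded gap, $$\tau(C) := \inf_{n} \frac{\operatorname{dist}\left(G_n, \bigcup_{1 \le i \le n-1} G_i \cup E\right)}{\operatorname{diam}(G_n)}.$$ If $C$ has no bounded gap, then $\tau(C) = +\infty$ if $C$ has non-empty interior and $\tau(C) = 0$ if $C$ has empty interior. Here $\operatorname{dist}$ is the usual (infimum) distance between non-empty subsets. Convention: $0 \cdot \infty = 0$. *)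

theory Defs
  imports "HOL-Analysis.Analysis"
begin

definition pinned_distance_set :: "'a::real_normed_vector \<Rightarrow> 'a set \<Rightarrow> real set"
  where "pinned_distance_set x B = {norm (x - y) | y. y \<in> B}"

(* For closed C the path components of the complement are automatically open. *)
definition complement_components :: "'a::euclidean_space set \<Rightarrow> 'a set set"
  where "complement_components C = path_component_set (- C) ` (- C)"

definition bounded_gaps :: "'a::euclidean_space set \<Rightarrow> 'a set set"
  where "bounded_gaps C = {U \<in> complement_components C. bounded U}"

(* For compact C and dimension at least 2 there is exactly one unbounded component, so the
   union is that component; on the line it is the union of the two unbounded intervals. *)
definition unbounded_gap :: "'a::euclidean_space set \<Rightarrow> 'a set"
  where "unbounded_gap C = \<Union> {U \<in> complement_components C. \<not> bounded U}"

(* Gaps are numbered from 1, up to their number if there are only finitely many. *)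
definition gap_indices :: "'a::euclidean_space set \<Rightarrow> nat set"
  where "gap_indices C = {n. 1 \<le> n \<and> (finite (bounded_gaps C) \<longrightarrow> n \<le> card (bounded_gaps C))}"

definition gap_ordering :: "'a::euclidean_space set \<Rightarrow> (nat \<Rightarrow> 'a set) \<Rightarrow> bool"
  where "gap_ordering C G \<longleftrightarrow>
    bij_betw G (gap_indices C) (bounded_gaps C) \<and>
    (\<forall>i\<in>gap_indices C. \<forall>j\<in>gap_indices C. i \<le> j \<longrightarrow> diameter (G j) \<le> diameter (G i))"

definition thickness_along :: "'a::euclidean_space set \<Rightarrow> (nat \<Rightarrow> 'a set) \<Rightarrow> ereal"
  where "thickness_along C G =
    (INF n\<in>gap_indices C.
       ereal (setdist (G n) ((\<Union>i\<in>{1..<n}. G i) \<union> unbounded_gap C) / diameter (G n)))"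

(* The choice of the ordering is irrelevant (lemma thickness_eq_thickness_along below).
   In dimension at least 2 the bounded gaps need not admit an ordering by non-increasing
   diameter of type at most omega.  This only happens if infinitely many of them have
   diameter at least some c > 0; infinitely many disjoint sets inside a bounded set come
   arbitrarily close to one another, so that the thickness is then taken to be 0.
   Products of extended reals satisfy 0 * \<infinity> = 0. *)
definition thickness :: "'a::euclidean_space set \<Rightarrow> ereal"
  where "thickness C =
    (if bounded_gaps C = {} then (if interior C \<noteq> {} then \<infinity> else 0)
     else if \<exists>G. gap_ordering C G then thickness_along C (SOME G. gap_ordering C G)
     else 0)"

lemma unbounded_gap_nonempty:
  fixes C :: "'a::euclidean_space set"
  assumes "bounded C"
  shows "unbounded_gap C \<noteq> {}"
proof -
  obtain r where r: "C \<subseteq> ball 0 r" "r > 0"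
    using assms bounded_subset_ballD by blast
  obtain b :: 'a where b: "b \<in> Basis" using nonempty_Basis by blast
  let ?R = "(\<lambda>t. t *\<^sub>R b) ` {r..}"
  have "path_connected ?R"
    by (intro path_connected_continuous_image convex_imp_path_connected continuous_intros) auto
  moreover have sub: "?R \<subseteq> - C" using r b by (auto simp: subset_iff)
  moreover have "r *\<^sub>R b \<in> ?R" by auto
  ultimately have "?R \<subseteq> path_component_set (- C) (r *\<^sub>R b)"
    by (intro path_component_maximal)
  moreover have "\<not> bounded ?R"
  proof
    assume "bounded ?R"
    then obtain K where K: "\<And>x. x \<in> ?R \<Longrightarrow> norm x \<le> K" unfolding bounded_iff by blast
    have "norm ((max r (K + 1)) *\<^sub>R b) \<le> K" by (rule K) auto
    then show False using b r by auto
  qed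
  ultimately have unb: "\<not> bounded (path_component_set (- C) (r *\<^sub>R b))"
    using bounded_subset by blast
  have mem: "r *\<^sub>R b \<in> - C" using sub by auto
  then have "r *\<^sub>R b \<in> path_component_set (- C) (r *\<^sub>R b)"
    by (simp add: path_component_refl)
  then show ?thesis using unb mem
    unfolding unbounded_gap_def complement_components_def by blast
qed

lemma setdist_Un_geI:
  assumes "e \<le> setdist A E" "\<And>V. V \<in> F \<Longrightarrow> e \<le> setdist A V" "A \<noteq> {}" "E \<noteq> {}"
  shows "e \<le> setdist A (\<Union>F \<union> E)"
proof (rule le_setdistI)
  fix x y assume "x \<in> A" "y \<in> \<Union>F \<union> E"
  then show "e \<le> dist x y"
    using assms(1,2) setdist_le_dist order_trans by (metis UnE UnionE)
qed (use assms in auto)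

lemma thickness_along_le:
  fixes C :: "'a::euclidean_space set"
  assumes "bounded C" and G: "gap_ordering C G" and H: "gap_ordering C H"
  shows "thickness_along C G \<le> thickness_along C H"
  unfolding thickness_along_def
proof (rule INF_greatest)
  let ?I = "gap_indices C" and ?E = "unbounded_gap C"
  let ?r = "\<lambda>n. setdist (G n) ((\<Union>i\<in>{1..<n}. G i) \<union> ?E) / diameter (G n)"
  let ?t = "INF n\<in>?I. ereal (?r n)"
  fix m assume m: "m \<in> ?I"
  have ne: "U \<noteq> {} \<and> bounded U" if "U \<in> bounded_gaps C" for U
    using that unfolding bounded_gaps_def complement_components_def
    using path_component_eq_empty[of "- C"] by blast
  have E: "?E \<noteq> {}" using assms(1) by (rule unbounded_gap_nonempty)
  have Gim: "G ` ?I = bounded_gaps C" and Him: "H ` ?I = bounded_gaps C"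
    and Ginj: "inj_on G ?I" and Hinj: "inj_on H ?I"
    using G H by (auto simp: gap_ordering_def bij_betw_def)
  have idx: "i \<in> ?I" if "n \<in> ?I" "i \<in> {1..<n}" for i n
    using that by (auto simp: gap_indices_def)
  obtain n where n: "n \<in> ?I" "G n = H m" using Gim Him m by (metis imageE imageI)
  have d0: "diameter (G n) \<ge> 0"
    using ne Gim n(1) by (intro diameter_ge_0) blast
  have key: "\<exists>k\<in>?I. diameter (G k) = diameter (G n) \<and>
      setdist (G k) ((\<Union>i\<in>{1..<k}. G i) \<union> ?E) \<le> setdist (G n) V"
    if V: "V \<in> bounded_gaps C" "V \<noteq> G n" "diameter (G n) \<le> diameter V" for V
  proof -
    obtain k where k: "k \<in> ?I" "G k = V" using V Gim by (metis imageE)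
    then have "k \<noteq> n" using V by auto
    then consider "k < n" | "n < k" by linarith
    then show ?thesis
    proof cases
      case 1
      then have "V \<subseteq> (\<Union>i\<in>{1..<n}. G i) \<union> ?E" using k by (auto simp: gap_indices_def)
      then show ?thesis using n(1) ne[OF V(1)] setdist_subset_right by blast
    next
      case 2
      then have "G n \<subseteq> (\<Union>i\<in>{1..<k}. G i) \<union> ?E" using n(1) by (auto simp: gap_indices_def)
      moreover have "G n \<noteq> {}" using ne Gim n(1) by blast
      ultimately have "setdist (G k) ((\<Union>i\<in>{1..<k}. G i) \<union> ?E) \<le> setdist V (G n)"
        using k setdist_subset_right by blast
      moreover have "diameter (G k) \<le> diameter (G n)"
        using G k n(1) 2 by (auto simp: gap_ordering_def)
      ultimately show ?thesis using V k by (metis order_antisym setdist_sym)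
    qed
  qed
  have bound: "?t \<le> ereal (s / diameter (G n))"
    if "k \<in> ?I" "diameter (G k) = diameter (G n)"
       "setdist (G k) ((\<Union>i\<in>{1..<k}. G i) \<union> ?E) \<le> s" for k s
  proof -
    have "?t \<le> ereal (?r k)" using that(1) by (rule INF_lower)
    also have "\<dots> \<le> ereal (s / diameter (G n))"
      using that d0 by (auto intro: divide_right_mono)
    finally show ?thesis .
  qed
  show "?t \<le> ereal (setdist (H m) ((\<Union>i\<in>{1..<m}. H i) \<union> ?E) / diameter (H m))"
  proof (cases "diameter (G n) = 0")
    case True
    have "?t \<le> ereal (?r n)" using n(1) by (rule INF_lower)
    then show ?thesis using True n(2) by simp
  next
    case False
    then have dpos: "diameter (G n) > 0" using d0 by simp
    have "?t \<le> ereal (?r n)" using n(1) by (rule INF_lower)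
    moreover have "?t \<ge> 0"
      by (rule INF_greatest)
        (use ne Gim in \<open>force intro!: divide_nonneg_nonneg diameter_ge_0 setdist_pos_le\<close>)
    ultimately obtain t where t: "?t = ereal t" by (cases ?t) auto
    have "t * diameter (G n) \<le> setdist (H m) (\<Union>(H ` {1..<m}) \<union> ?E)"
    proof (rule setdist_Un_geI)
      have "setdist (G n) ((\<Union>i\<in>{1..<n}. G i) \<union> ?E) \<le> setdist (G n) ?E"
        using E by (intro setdist_subset_right) auto
      from bound[OF n(1) refl this] show "t * diameter (G n) \<le> setdist (H m) ?E"
        using t dpos n(2) by (simp add: pos_le_divide_eq)
    next
      fix V assume "V \<in> H ` {1..<m}"
      then obtain i where i: "i \<in> {1..<m}" "V = H i" by auto
      have iI: "i \<in> ?I" using idx m i by blast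
      have "V \<in> bounded_gaps C" using iI i Him by blast
      moreover have "V \<noteq> G n" using n(2) i iI m Hinj by (auto dest: inj_onD)
      moreover have "diameter (G n) \<le> diameter V"
        using H i iI m n(2) by (auto simp: gap_ordering_def)
      ultimately obtain k where "k \<in> ?I" "diameter (G k) = diameter (G n)"
        "setdist (G k) ((\<Union>i\<in>{1..<k}. G i) \<union> ?E) \<le> setdist (G n) V"
        using key by blast
      from bound[OF this] show "t * diameter (G n) \<le> setdist (H m) V"
        using t dpos n(2) by (simp add: pos_le_divide_eq)
    next
      show "H m \<noteq> {}" using ne Him m by blast
    qed (rule E)
    then show ?thesis using t dpos n(2) by (simp add: pos_le_divide_eq)
  qed
qed

lemma thickness_eq_thickness_along:
  fixes C :: "'a::euclidean_space set"
  assumes "bounded C" "bounded_gaps C \<noteq> {}" "gap_ordering C G"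
  shows "thickness C = thickness_along C G"
proof -
  have "gap_ordering C (SOME G. gap_ordering C G)" using assms(3) by (intro someI_ex[of "gap_ordering C"] exI)
  then have "thickness_along C (SOME G. gap_ordering C G) = thickness_along C G"
    using assms thickness_along_le by (blast intro: antisym)
  then show ?thesis using assms by (auto simp: thickness_def)
qed

end

theory Submission
  imports Defs
begin

text \<open>The squared distance from \<open>(x, x')\<close> to \<open>(y, y')\<close> is \<open>(dist x y)\<^sup>2 + (dist x' y')\<^sup>2\<close>, so
it suffices to find an interval of numbers that have this form for every
\<open>(x, x')\<close> near \<open>x0\<close>, with \<open>y\<close> in \<open>C1\<close> and \<open>y'\<close> in \<open>C2\<close>. This is the predicate
\<open>stable_square_sums\<close>.

Sometimes one factor does all the work and the point of the other factor stays fixed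
(\<open>stable_square_sums_of_spheres\<close>). This happens if one factor has interior. It also happens
if the dimension is at least 2 and one factor has a bounded gap \<open>U\<close> and positive thickness. Let
\<open>R\<close> be the largest distance from \<open>x\<close> to a point of the closure of \<open>U\<close>. If a sphere about \<open>x\<close>
with radius slightly above \<open>R\<close> missed the set, it would lie in a single component of the
complement, since it is connected. That component is not \<open>U\<close>, it comes very close to \<open>U\<close>, and it is
unbounded or has at least the diameter of \<open>U\<close>; positive thickness excludes this.
So all radii slightly above \<open>R\<close> are distances from \<open>x\<close>.

On the line both factors are needed. If a factor has empty interior, its positive thickness
forces it to have a bounded gap. That gap does not contain the point \<open>x\<close> of the factor, so its
endpoint \<open>c\<close> far from \<open>x\<close> is different from \<open>x\<close>. Beyond \<open>c\<close>, and close to it, the length of a gap is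
at most its distance from \<open>c\<close> divided by the thickness; in this sense the factor is thick on one side of \<open>c\<close>. The
map \<open>y \<mapsto> (y - x)\<^sup>2 - (c - x)\<^sup>2\<close> is almost affine near \<open>c\<close>, so it costs arbitrarily little thickness
(\<open>one_sided_thick_square_image\<close>). What remains is that a sum of two sets that are thick to the
right of 0 contains all small positive numbers \<open>e\<close> if the product of the thicknesses exceeds 1
(\<open>one_sided_thick_sum\<close>). This is the gap lemma of Newhouse for \<open>A\<close> and \<open>e - B\<close>: if
they were disjoint, a gap of one would overlap a gap of the other, neither containing the other,
and one of the two could always be exchanged for a gap that is shorter by a fixed amount.\<close>

section \<open>Square sums\<close>

text \<open>The neighbourhood is a product of neighbourhoods of \<open>a\<close> and \<open>b\<close>, which makes the notion symmetric
in the two factors; the interval works for all its points at once.\<close>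
definition stable_square_sums :: "'a::metric_space \<Rightarrow> 'a set \<Rightarrow> 'a \<Rightarrow> 'a set \<Rightarrow> bool"
  where "stable_square_sums a A b B \<longleftrightarrow>
    (\<exists>M N s t. open M \<and> a \<in> M \<and> open N \<and> b \<in> N \<and> 0 \<le> s \<and> s < t \<and>
      (\<forall>x\<in>M. \<forall>x'\<in>N. \<forall>u\<in>{s<..<t}. \<exists>y\<in>A. \<exists>y'\<in>B. (dist x y)\<^sup>2 + (dist x' y')\<^sup>2 = u))"

lemma stable_square_sums_sym:
  assumes "stable_square_sums a A b B"
  shows "stable_square_sums b B a A"
proof -
  from assms obtain M N s t where MN: "open M" "a \<in> M" "open N" "b \<in> N" "0 \<le> s" "s < t"
    and *: "\<forall>x\<in>M. \<forall>x'\<in>N. \<forall>u\<in>{s<..<t}. \<exists>y\<in>A. \<exists>y'\<in>B. (dist x y)\<^sup>2 + (dist x' y')\<^sup>2 = u"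
    unfolding stable_square_sums_def by (elim exE conjE) (rule that)
  have "\<exists>y\<in>B. \<exists>y'\<in>A. (dist x y)\<^sup>2 + (dist x' y')\<^sup>2 = u"
    if "x \<in> N" "x' \<in> M" "u \<in> {s<..<t}" for x x' u
    using *[rule_format, OF that(2,1,3)] by (auto simp: add.commute)
  then show ?thesis unfolding stable_square_sums_def using MN
    by (intro exI[of _ N] exI[of _ M] exI[of _ s] exI[of _ t]) auto
qed

lemma pinned_distances_of_stable_square_sums:
  fixes A B :: "'a::real_normed_vector set"
  assumes "stable_square_sums a A b B"
  shows "\<exists>S. open S \<and> (a, b) \<in> S \<and> interior (\<Inter>x\<in>S. pinned_distance_set x (A \<times> B)) \<noteq> {}"
proof -
  from assms obtain M N s t where MN: "open M" "a \<in> M" "open N" "b \<in> N" and st: "0 \<le> s" "s < t"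
    and *: "\<forall>x\<in>M. \<forall>x'\<in>N. \<forall>u\<in>{s<..<t}. \<exists>y\<in>A. \<exists>y'\<in>B. (dist x y)\<^sup>2 + (dist x' y')\<^sup>2 = u"
    unfolding stable_square_sums_def by (elim exE conjE) (rule that)
  have "{sqrt s<..<sqrt t} \<subseteq> (\<Inter>x\<in>M \<times> N. pinned_distance_set x (A \<times> B))"
  proof clarify
    fix r x x' assume r: "r \<in> {sqrt s<..<sqrt t}" and x: "x \<in> M" "x' \<in> N"
    have "0 < r" using r st by (smt (verit) greaterThanLessThan_iff real_sqrt_ge_zero)
    have "sqrt s < sqrt (r\<^sup>2)" "sqrt (r\<^sup>2) < sqrt t" using r \<open>0 < r\<close> by auto
    then have "r\<^sup>2 \<in> {s<..<t}" by (simp only: real_sqrt_less_iff greaterThanLessThan_iff)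
    then obtain y y' where y: "y \<in> A" "y' \<in> B" "(dist x y)\<^sup>2 + (dist x' y')\<^sup>2 = r\<^sup>2"
      using * x by blast
    have "norm ((x, x') - (y, y')) = sqrt ((dist x y)\<^sup>2 + (dist x' y')\<^sup>2)"
      by (simp add: norm_Pair dist_norm)
    also have "\<dots> = r" using y \<open>0 < r\<close> by simp
    finally show "r \<in> pinned_distance_set (x, x') (A \<times> B)"
      using y unfolding pinned_distance_set_def by force
  qed
  then have "{sqrt s<..<sqrt t} \<subseteq> interior (\<Inter>x\<in>M \<times> N. pinned_distance_set x (A \<times> B))"
    by (intro interior_maximal) auto
  moreover have "{sqrt s<..<sqrt t} \<noteq> {}" using st by simp
  moreover have "open (M \<times> N)" "(a, b) \<in> M \<times> N" using MN by (auto intro: open_Times)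
  ultimately show ?thesis by blast
qed

text \<open>The second summand is held at \<open>y' = b\<close>, where it is as small as desired if \<open>x'\<close> is near \<open>b\<close>. The
radii that are hit in \<open>A\<close> form an interval that starts at \<open>h x\<close> and has length \<open>e\<close>; since \<open>h\<close> moves
no faster than \<open>x\<close>, the middle half of this interval for \<open>x = a\<close> is hit from all \<open>x\<close> near \<open>a\<close>.\<close>
lemma stable_square_sums_of_spheres:
  fixes A B :: "'a::metric_space set"
  assumes e: "0 < e" and h: "0 \<le> h a" "\<And>x. \<bar>h x - h a\<bar> \<le> dist x a"
    and hit: "\<And>x r. h x < r \<Longrightarrow> r < h x + e \<Longrightarrow> \<exists>y\<in>A. dist x y = r"
    and b: "b \<in> B"
  shows "stable_square_sums a A b B"
proof -
  define s where "s = h a + e / 4"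
  define t where "t = h a + 3 * e / 4"
  have st: "0 \<le> s" "s < t" using e h by (auto simp: s_def t_def)
  then have sq: "s\<^sup>2 < t\<^sup>2" by (simp add: power_strict_mono)
  define g where "g = sqrt ((t\<^sup>2 - s\<^sup>2) / 2)"
  have g: "0 < g" "g\<^sup>2 = (t\<^sup>2 - s\<^sup>2) / 2" using sq by (auto simp: g_def)
  have "\<exists>y\<in>A. \<exists>y'\<in>B. (dist x y)\<^sup>2 + (dist x' y')\<^sup>2 = u"
    if "x \<in> ball a (e / 4)" "x' \<in> ball b g" "u \<in> {s\<^sup>2 + g\<^sup>2<..<t\<^sup>2}" for x x' u
  proof -
    have "(dist x' b)\<^sup>2 \<le> g\<^sup>2" using that by (intro power_mono) (auto simp: dist_commute)
    then have v: "s\<^sup>2 < u - (dist x' b)\<^sup>2" "u - (dist x' b)\<^sup>2 < t\<^sup>2"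
      using that(3) zero_le_power2[of "dist x' b"] unfolding greaterThanLessThan_iff by linarith+
    define r where "r = sqrt (u - (dist x' b)\<^sup>2)"
    have "0 \<le> u - (dist x' b)\<^sup>2" using v(1) zero_le_power2[of s] by linarith
    then have r2: "r\<^sup>2 = u - (dist x' b)\<^sup>2" by (simp add: r_def)
    have "s < r" "r < t" unfolding r_def using v st by (auto intro: real_less_rsqrt real_less_lsqrt)
    moreover have "\<bar>h x - h a\<bar> < e / 4" using h(2)[of x] that by (simp add: dist_commute)
    ultimately have "h x < r" "r < h x + e"
      unfolding s_def t_def abs_less_iff by linarith+
    then obtain y where "y \<in> A" "dist x y = r" using hit by blast
    then show ?thesis using b r2 by (intro bexI[of _ y] bexI[of _ b]) auto
  qed
  then have "\<forall>x\<in>ball a (e / 4). \<forall>x'\<in>ball b g. \<forall>u\<in>{s\<^sup>2 + g\<^sup>2<..<t\<^sup>2}.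
      \<exists>y\<in>A. \<exists>y'\<in>B. (dist x y)\<^sup>2 + (dist x' y')\<^sup>2 = u" by blast
  moreover have "s\<^sup>2 + g\<^sup>2 < t\<^sup>2" using sq g by simp
  ultimately show ?thesis unfolding stable_square_sums_def
    using e g(1)
    by (intro exI[of _ "ball a (e / 4)"] exI[of _ "ball b g"] exI[of _ "s\<^sup>2 + g\<^sup>2"]
        exI[of _ "t\<^sup>2"] conjI; (assumption | simp))
qed

text \<open>On the ray from \<open>x\<close> through the centre \<open>c\<close> of a ball inside \<open>A\<close>, the part of the ball beyond \<open>c\<close>
realizes all distances from \<open>dist x c\<close> to \<open>dist x c + e\<close>.\<close>
lemma stable_square_sums_interior:
  fixes A B :: "'a::euclidean_space set"
  assumes "interior A \<noteq> {}" "b \<in> B"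
  shows "stable_square_sums a A b B"
proof -
  obtain c e where c: "0 < e" "ball c e \<subseteq> A"
    using assms(1) by (metis all_not_in_conv mem_interior)
  show ?thesis
  proof (rule stable_square_sums_of_spheres[where h = "\<lambda>x. dist x c" and e = e])
    show "\<bar>dist x c - dist a c\<bar> \<le> dist x a" for x
      by (metis abs_dist_diff_le dist_commute)
    fix x r assume r: "dist x c < r" "r < dist x c + e"
    obtain v where v: "norm v = 1" "c - x = dist x c *\<^sub>R v"
    proof (cases "x = c")
      case True
      obtain v :: 'a where "norm v = 1" using vector_choose_size[of 1] by auto
      then show ?thesis using that[of v] True by simp
    next
      case False
      then show ?thesis
        using that[of "(c - x) /\<^sub>R dist x c"] by (simp add: dist_norm norm_minus_commute)
    qed
    have "c = x + dist x c *\<^sub>R v" using v(2) by (simp add: algebra_simps)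
    then have "c - (x + r *\<^sub>R v) = (dist x c - r) *\<^sub>R v" by (simp add: algebra_simps)
    then have "dist c (x + r *\<^sub>R v) = r - dist x c" using v r by (simp add: dist_norm)
    then have "x + r *\<^sub>R v \<in> A" using r by (intro subsetD[OF c(2)]) simp
    moreover have "0 < r" using r zero_le_dist[of x c] by linarith
    then have "dist x (x + r *\<^sub>R v) = r" using v by (simp add: dist_norm)
    ultimately show "\<exists>y\<in>A. dist x y = r" by blast
  qed (use assms c in auto)
qed

section \<open>Separation of the gaps of a thick set\<close>

lemma thickness_nonneg:
  fixes C :: "'a::euclidean_space set"
  shows "0 \<le> thickness C"
proof -
  have "0 \<le> thickness_along C G" if "gap_ordering C G" for G
    unfolding thickness_along_def
  proof (rule INF_greatest)
    fix n assume "n \<in> gap_indices C"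
    then have "bounded (G n)" using that by (auto simp: gap_ordering_def bij_betw_def bounded_gaps_def)
    then show "0 \<le> ereal (setdist (G n) ((\<Union>i\<in>{1..<n}. G i) \<union> unbounded_gap C) / diameter (G n))"
      by (simp add: diameter_ge_0 setdist_pos_le)
  qed
  then show ?thesis using someI_ex[of "gap_ordering C"] by (auto simp: thickness_def)
qed

lemma thickness_finite:
  fixes C :: "'a::euclidean_space set"
  assumes "bounded_gaps C \<noteq> {}"
  shows "thickness C < \<infinity>"
proof -
  have "thickness_along C G < \<infinity>" if "gap_ordering C G" for G
  proof -
    have "gap_indices C \<noteq> {}" using that assms by (auto simp: gap_ordering_def bij_betw_def)
    then obtain n where "n \<in> gap_indices C" by blast
    then have "thickness_along C G \<le> ereal (setdist (G n) ((\<Union>i\<in>{1..<n}. G i) \<union> unbounded_gap C) / diameter (G n))"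
      unfolding thickness_along_def by (rule INF_lower)
    then show ?thesis using ereal_infty_less(1) order_le_less_trans by fastforce
  qed
  then show ?thesis using assms someI_ex[of "gap_ordering C"] by (auto simp: thickness_def)
qed

lemma diameter_bounded_gap_pos:
  fixes C :: "'a::euclidean_space set"
  assumes C: "compact C" and U: "U \<in> bounded_gaps C"
  shows "0 < diameter U"
proof -
  have U': "U \<noteq> {}" "open U" "bounded U"
    using U C path_component_eq_empty[of "- C"] open_path_component[of "- C"]
    unfolding bounded_gaps_def complement_components_def
    by (auto simp: compact_imp_closed open_Compl)
  obtain x where x: "x \<in> U" using U' by blast
  obtain b :: 'a where b: "b \<in> Basis" using nonempty_Basis by blast
  obtain r where r: "0 < r" "ball x r \<subseteq> U" using U'(2) x open_contains_ball by blast
  have "x + (r/2) *\<^sub>R b \<in> U" using r b by (intro subsetD[OF r(2)]) (auto simp: dist_norm)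
  then have "dist x (x + (r/2) *\<^sub>R b) \<le> diameter U"
    using diameter_bounded_bound[OF U'(3) x] by blast
  then show ?thesis using r b by (simp add: dist_norm)
qed

text \<open>The geometric content of thickness, in the form in which the proof uses it.
Of two bounded gaps, the one that comes later
in the ordering is the one whose diameter the definition compares with their distance; the minimum
of the diameters gives a bound that does not mention the ordering.\<close>
lemma bounded_gap_separation:
  fixes C :: "'a::euclidean_space set"
  assumes C: "compact C" and t: "ereal t \<le> thickness C" "0 < t" and U: "U \<in> bounded_gaps C"
  shows "w \<in> closure (unbounded_gap C) \<Longrightarrow> u \<in> closure U \<Longrightarrow> t * diameter U \<le> dist u w"
    and "V \<in> bounded_gaps C \<Longrightarrow> U \<noteq> V \<Longrightarrow> u \<in> closure U \<Longrightarrow> v \<in> closure V \<Longrightarrow>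
           t * min (diameter U) (diameter V) \<le> dist u v"
proof -
  have "\<exists>G. gap_ordering C G"
    using t U by (auto simp: thickness_def split: if_splits)
  then obtain G where G: "gap_ordering C G" by blast
  have img: "G ` gap_indices C = bounded_gaps C" using G by (auto simp: gap_ordering_def bij_betw_def)
  have key: "t * diameter (G n) \<le> dist u v"
    if n: "n \<in> gap_indices C" and u: "u \<in> closure (G n)"
      and v: "v \<in> closure W" and W: "W \<subseteq> (\<Union>i\<in>{1..<n}. G i) \<union> unbounded_gap C" for n u v W
  proof -
    have "ereal t \<le> thickness_along C G"
      using thickness_eq_thickness_along[OF compact_imp_bounded[OF C] _ G] U t by force
    also have "\<dots> \<le> ereal (setdist (G n) ((\<Union>i\<in>{1..<n}. G i) \<union> unbounded_gap C) / diameter (G n))"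
      unfolding thickness_along_def using n by (rule INF_lower)
    finally have "t * diameter (G n) \<le> setdist (G n) ((\<Union>i\<in>{1..<n}. G i) \<union> unbounded_gap C)"
      using diameter_bounded_gap_pos[OF C] imageI[OF n, of G] unfolding img
      by (simp add: pos_le_divide_eq)
    also have "\<dots> \<le> setdist (G n) W"
      using W v by (intro setdist_subset_right) auto
    also have "\<dots> = setdist (closure (G n)) (closure W)" by simp
    also have "\<dots> \<le> dist u v" using u v by (rule setdist_le_dist)
    finally show ?thesis .
  qed
  obtain n where n: "n \<in> gap_indices C" "G n = U" using img U by (metis imageE)
  show "t * diameter U \<le> dist u w" if "w \<in> closure (unbounded_gap C)" "u \<in> closure U"
    using key[OF n(1) _ that(1)] n that by auto
  show "t * min (diameter U) (diameter V) \<le> dist u v"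
    if V: "V \<in> bounded_gaps C" "U \<noteq> V" and u: "u \<in> closure U" and v: "v \<in> closure V"
  proof -
    obtain k where k: "k \<in> gap_indices C" "G k = V" using img V by (metis imageE)
    have "k \<noteq> n" using n k V by auto
    then consider "k < n" | "n < k" by linarith
    then show ?thesis
    proof cases
      case 1
      then have "V \<subseteq> (\<Union>i\<in>{1..<n}. G i) \<union> unbounded_gap C" using k by (auto simp: gap_indices_def)
      then have "t * diameter U \<le> dist u v" using key[OF n(1) _ v] n u by auto
      moreover have "t * min (diameter U) (diameter V) \<le> t * diameter U" using t by simp
      ultimately show ?thesis by linarith
    next
      case 2
      then have "U \<subseteq> (\<Union>i\<in>{1..<k}. G i) \<union> unbounded_gap C" using n by (auto simp: gap_indices_def)
      then have "t * diameter V \<le> dist v u" using key[OF k(1) _ u] k v by auto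
      moreover have "t * min (diameter U) (diameter V) \<le> t * diameter V" using t by simp
      ultimately show ?thesis by (simp add: dist_commute)
    qed
  qed
qed

section \<open>Dimension at least two\<close>

text \<open>A connected sphere cannot pass through several gaps without meeting \<open>A\<close>, so missing \<open>A\<close> forces
it into one gap, which is then both large and close to \<open>U\<close>. Taking the farthest point of the
closure of \<open>U\<close> guarantees that this gap is not \<open>U\<close> itself.\<close>
lemma stable_square_sums_higher_dim:
  fixes A B :: "'a::euclidean_space set"
  assumes dim: "2 \<le> DIM('a)" and A: "compact A" "bounded_gaps A \<noteq> {}" "0 < thickness A"
    and b: "b \<in> B"
  shows "stable_square_sums a A b B"
proof -
  obtain t where t: "0 < t" "ereal t \<le> thickness A"
    using ereal_dense2[OF A(3)] by (auto simp: less_imp_le)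
  obtain U where U: "U \<in> bounded_gaps A" using A by blast
  have U': "U \<noteq> {}" "bounded U" using U path_component_eq_empty[of "- A"]
    unfolding bounded_gaps_def complement_components_def by auto
  have dU: "0 < diameter U" using diameter_bounded_gap_pos[OF A(1) U] .
  have cU: "compact (closure U)" "closure U \<noteq> {}" using U' by (auto simp: compact_closure)
  define h where "h x = (SUP u\<in>closure U. dist x u)" for x
  have h: "\<exists>q\<in>closure U. h x = dist x q \<and> (\<forall>u\<in>closure U. dist x u \<le> dist x q)" for x
  proof -
    obtain q where q: "q \<in> closure U" "\<forall>u\<in>closure U. dist x u \<le> dist x q"
      using continuous_attains_sup[OF cU, of "dist x"] continuous_on_dist[OF continuous_on_const continuous_on_id]
      by blast
    then have "h x = dist x q" unfolding h_def by (intro cSup_eq_maximum) auto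
    then show ?thesis using q by blast
  qed
  have lip: "h x \<le> h y + dist x y" for x y
  proof -
    obtain q where q: "q \<in> closure U" "h x = dist x q" using h by blast
    have "dist y q \<le> h y" using h[of y] q by auto
    then show ?thesis using q dist_triangle[of x q y] by linarith
  qed
  show ?thesis
  proof (rule stable_square_sums_of_spheres[where h = h and e = "t * diameter U"])
    show "0 \<le> h a" using h[of a] by auto
    show "\<bar>h x - h a\<bar> \<le> dist x a" for x
      using lip[of x a] lip[of a x] by (simp add: abs_le_iff dist_commute)
    fix x r assume r: "h x < r" "r < h x + t * diameter U"
    obtain q where q: "q \<in> closure U" "h x = dist x q" "\<And>u. u \<in> closure U \<Longrightarrow> dist x u \<le> dist x q"
      using h[of x] by blast
    have "diameter U \<le> 2 * h x"
    proof (rule diameter_le)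
      fix u v assume "u \<in> U" "v \<in> U"
      then have "dist x u \<le> h x" "dist x v \<le> h x" using q closure_subset by auto
      then show "norm (u - v) \<le> 2 * h x"
        using dist_triangle3[of u v x] by (simp add: dist_norm)
    qed (use U' in auto)
    then have R: "0 < h x" using dU by simp
    define p where "p = x + (r / h x) *\<^sub>R (q - x)"
    have nq: "norm (q - x) = h x" using q(2) by (simp add: dist_norm norm_minus_commute)
    have px: "dist x p = r" using R r nq by (simp add: p_def dist_norm)
    have "p - q = (r / h x - 1) *\<^sub>R (q - x)" by (simp add: p_def algebra_simps)
    then have "dist q p = \<bar>r / h x - 1\<bar> * h x" using nq by (simp add: dist_norm norm_minus_commute)
    also have "\<dots> = r - h x" using R r by (simp add: abs_if field_simps)
    finally have qp: "dist q p < t * diameter U" using r by simp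
    show "\<exists>y\<in>A. dist x y = r"
    proof (rule ccontr)
      assume none: "\<not> ?thesis"
      let ?K = "path_component_set (- A) p"
      have "sphere x r \<subseteq> - A" using none by auto
      moreover have "path_connected (sphere x r)" using dim by (intro path_connected_sphere) auto
      ultimately have K: "sphere x r \<subseteq> ?K" using px by (intro path_component_maximal) auto
      have pK: "p \<in> ?K" using K px by auto
      have "p \<in> - A" using none px by auto
      then have comp: "?K \<in> complement_components A" by (auto simp: complement_components_def)
      show False
      proof (cases "bounded ?K")
        case False
        then have "p \<in> unbounded_gap A" using comp pK by (auto simp: unbounded_gap_def)
        then have "t * diameter U \<le> dist q p"
          using bounded_gap_separation(1)[OF A(1) t(2,1) U _ q(1)] closure_subset by blast
        then show False using qp by simp
      next
        case True
        then have KB: "?K \<in> bounded_gaps A" using comp by (auto simp: bounded_gaps_def)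
        have "p \<notin> closure U" using q(3)[of p] px r q(2) by auto
        then have "U \<noteq> ?K" using pK closure_subset by blast
        then have "t * min (diameter U) (diameter ?K) \<le> dist q p"
          using bounded_gap_separation(2)[OF A(1) t(2,1) U KB _ q(1)] pK closure_subset by blast
        \<comment> \<open>The component contains two antipodal points of the sphere.\<close>
        moreover have "diameter U \<le> diameter ?K"
        proof -
          have *: "dist x (2 *\<^sub>R x - p) = dist x p" by (simp add: dist_norm scaleR_2 norm_minus_commute)
          have "2 *\<^sub>R x - p \<in> ?K" using K px * by auto
          then have "dist (2 *\<^sub>R x - p) p \<le> diameter ?K"
            using diameter_bounded_bound[OF True] pK by blast
          moreover have "2 *\<^sub>R x - p - p = 2 *\<^sub>R (x - p)" by (simp add: scaleR_2)
          then have "dist (2 *\<^sub>R x - p) p = 2 * dist x p" by (simp add: dist_norm)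
          ultimately show ?thesis using px r \<open>diameter U \<le> 2 * h x\<close> by linarith
        qed
        ultimately show False using qp by (simp add: min_def split: if_splits)
      qed
    qed
  qed (use t dU b in auto)
qed

section \<open>The gap lemma on the real line\<close>

definition gap :: "real set \<Rightarrow> real \<Rightarrow> real \<Rightarrow> bool"
  where "gap A p q \<longleftrightarrow> p \<in> A \<and> q \<in> A \<and> p < q \<and> {p<..<q} \<inter> A = {}"

lemma gap_around:
  assumes "compact A" "w \<notin> A" "l \<in> A" "l < w" "u \<in> A" "w < u"
  shows "\<exists>p q. gap A p q \<and> l \<le> p \<and> p < w \<and> w < q \<and> q \<le> u"
proof -
  have "compact (A \<inter> {..w})" "compact (A \<inter> {w..})"
    using assms(1) by (auto intro: compact_Int_closed)
  moreover have "l \<in> A \<inter> {..w}" "u \<in> A \<inter> {w..}" using assms by auto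
  ultimately obtain p q
    where p: "p \<in> A \<inter> {..w}" "\<And>y. y \<in> A \<inter> {..w} \<Longrightarrow> y \<le> p"
      and q: "q \<in> A \<inter> {w..}" "\<And>y. y \<in> A \<inter> {w..} \<Longrightarrow> q \<le> y"
    by (metis compact_attains_sup compact_attains_inf empty_iff)
  have pw: "p < w" "w < q" using p(1) q(1) assms(2) by (auto simp: less_le)
  have "y \<le> p \<or> q \<le> y" if "y \<in> A" for y using p(2)[of y] q(2)[of y] that by force
  then have "gap A p q" using p(1) q(1) pw by (force simp: gap_def)
  then show ?thesis using pw p(2)[of l] q(2)[of u] assms by auto
qed

text \<open>Local thickness \<open>T\<close> to the right of the point 0, on the scale \<open>d\<close>. Only gaps that start in
\<open>[0, d)\<close> are restricted, and the rest of the set is arbitrary. The space to the left of 0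
counts as a long gap, which gives the first inequality, and the point
beyond \<open>d\<close> ensures that every missing point between 0 and \<open>d\<close> lies in a bounded gap.\<close>
definition one_sided_thick :: "real \<Rightarrow> real \<Rightarrow> real set \<Rightarrow> bool"
  where "one_sided_thick T d A \<longleftrightarrow> compact A \<and> 0 \<in> A \<and> (\<exists>z\<in>A. d \<le> z) \<and>
    (\<forall>p q. gap A p q \<longrightarrow> 0 \<le> p \<longrightarrow> p < d \<longrightarrow> T * (q - p) \<le> p) \<and>
    (\<forall>p q p' q'. gap A p q \<longrightarrow> gap A p' q' \<longrightarrow> 0 \<le> p \<longrightarrow> q \<le> p' \<longrightarrow> p' < d \<longrightarrow>
       T * min (q - p) (q' - p') \<le> p' - q)"

text \<open>The gaps \<open>(p, q)\<close> of \<open>A\<close> and \<open>(e - s, e - r)\<close> of the reflected set \<open>e - B\<close> overlap, and each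
contains exactly one endpoint of the other. Writing this in terms of sums keeps the roles of \<open>A\<close>
and \<open>B\<close> interchangeable.\<close>
definition linked :: "real \<Rightarrow> real \<Rightarrow> real \<Rightarrow> real \<Rightarrow> real \<Rightarrow> bool"
  where "linked e p q r s \<longleftrightarrow>
    (p + s < e \<and> e < q + s \<and> q + r < e) \<or> (e < p + s \<and> p + r < e \<and> e < q + r)"

lemma linked_sym: "linked e p q r s \<longleftrightarrow> linked e r s p q"
  by (auto simp: linked_def add.commute)

text \<open>The gap \<open>(e - s, e - r)\<close> of the reflected set sticks out of \<open>(p, q)\<close> at one end. The endpoint there
is not in \<open>A\<close>, hence lies in another gap of \<open>A\<close>, linked with the same gap of \<open>B\<close>. The two
gaps of \<open>A\<close> are closer to each other than \<open>T * (q - p)\<close>, so thickness makes the new one shorter. The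
distance \<open>h\<close> of \<open>e\<close> from all sums \<open>a + b\<close> turns this into a definite gain, which
makes the descent terminate.\<close>
lemma smaller_linked_gap:
  assumes A: "one_sided_thick T d A" and T: "0 < T" and "e < d"
    and U: "gap A p q" "0 \<le> p" and V: "gap B r s" "0 \<le> r" and link: "linked e p q r s"
    and sep: "\<And>a b. a \<in> A \<Longrightarrow> b \<in> B \<Longrightarrow> h \<le> \<bar>a + b - e\<bar>" and h: "0 < h"
    and small: "s - r < T * (q - p)"
  obtains p' q' where "gap A p' q'" "0 \<le> p'" "linked e p' q' r s"
    "T * (q' - p') \<le> T * (q - p) - h"
proof -
  have cA: "compact A" and zA: "0 \<in> A" using A by (auto simp: one_sided_thick_def)
  obtain z where z: "z \<in> A" "d \<le> z" using A by (auto simp: one_sided_thick_def)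
  have t1: "T * (q - p) \<le> p" if "p < d" using A U that by (auto simp: one_sided_thick_def)
  have t2: "T * min (q1 - p1) (q2 - p2) \<le> p2 - q1"
    if "gap A p1 q1" "gap A p2 q2" "0 \<le> p1" "q1 \<le> p2" "p2 < d" for p1 q1 p2 q2
    using A that unfolding one_sided_thick_def by blast
  have mem: "p \<in> A" "q \<in> A" "p < q" "r \<in> B" "s \<in> B" "r < s"
    using U V by (auto simp: gap_def)
  have less: "T * y \<le> T * (q - p) - h" if "T * min y (q - p) \<le> T * (q - p) - h" for y
    using that h by (cases "y \<le> q - p") (auto simp: min_def)
  consider "p + s < e" "e < q + s" "q + r < e" | "e < p + s" "p + r < e" "e < q + r"
    using link by (auto simp: linked_def)
  then show thesis
  proof cases
    case 1
    \<comment> \<open>The gap of \<open>e - B\<close> sticks out on the right.\<close>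
    have "e - r \<notin> A" using sep[of "e - r" r] mem h by auto
    then obtain p' q' where g: "gap A p' q'" "q \<le> p'" "p' < e - r" "e - r < q'"
      using gap_around[OF cA, of "e - r" q z] mem z 1 V \<open>e < d\<close> by auto
    have "h \<le> \<bar>q + s - e\<bar>" "h \<le> \<bar>p' + r - e\<bar>"
      using sep mem g(1) by (auto simp: gap_def)
    then have "T * min (q' - p') (q - p) \<le> T * (q - p) - h"
      using t2[OF U(1) g(1) U(2) g(2)] g 1 V small h \<open>e < d\<close> by (simp add: min.commute)
    then show thesis
      using that[of p' q'] less g U mem 1 by (auto simp: linked_def)
  next
    case 2
    \<comment> \<open>It sticks out on the left, and not beyond 0, since it is short compared with \<open>p\<close>.\<close>
    have "p < d" using 2 V \<open>e < d\<close> by auto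
    then have pos: "0 < e - s" using t1 small 2 by argo
    have "e - s \<notin> A" using sep[of "e - s" s] mem h by auto
    then obtain p' q' where g: "gap A p' q'" "0 \<le> p'" "p' < e - s" "e - s < q'" "q' \<le> p"
      using gap_around[OF cA, of "e - s" 0 p] mem zA 2 pos by auto
    have "h \<le> \<bar>p + r - e\<bar>" "h \<le> \<bar>q' + s - e\<bar>"
      using sep mem g(1) by (auto simp: gap_def)
    then have "T * min (q' - p') (q - p) \<le> T * (q - p) - h"
      using t2[OF g(1) U(1) g(2) g(5) \<open>p < d\<close>] g 2 small h by simp
    then show thesis
      using that[of p' q'] less g 2 by (auto simp: linked_def)
  qed
qed

text \<open>Since \<open>T * T' > 1\<close>, in a linked pair one of the two gaps is shorter than the thickness times
the length of the other, so that the other can be replaced by a shorter one. Each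
replacement lowers \<open>T * (q - p) + T' * (s - r)\<close> by at least \<open>h\<close>, which is impossible forever. A first
linked pair exists because 0 belongs to both sets: \<open>e\<close> lies in a gap of \<open>B\<close>, and the reflected
endpoint of that gap lies in a gap of \<open>A\<close>.\<close>
lemma one_sided_thick_sum:
  assumes A: "one_sided_thick T d A" and B: "one_sided_thick T' d' B"
    and T: "0 < T" "0 < T'" "1 < T * T'" and e: "0 < e" "e < d" "e < d'"
  shows "\<exists>a\<in>A. \<exists>b\<in>B. a + b = e"
proof (rule ccontr)
  assume "\<not> ?thesis"
  then have ne: "a + b \<noteq> e" if "a \<in> A" "b \<in> B" for a b using that by blast
  have cA: "compact A" "0 \<in> A" and cB: "compact B" "0 \<in> B"
    using A B by (auto simp: one_sided_thick_def)
  let ?S = "{a + b | a b. a \<in> A \<and> b \<in> B}"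
  have "closed ?S"
    using compact_sums[OF cA(1) cB(1)] by (rule compact_imp_closed)
  moreover have "e \<notin> ?S" using ne by auto
  ultimately have "\<exists>h>0. \<forall>y\<in>?S. h \<le> dist e y"
    by (rule separate_point_closed)
  then obtain h where h: "0 < h" "\<forall>y\<in>?S. h \<le> dist e y" by blast
  have sep: "h \<le> \<bar>a + b - e\<bar>" if "a \<in> A" "b \<in> B" for a b
  proof -
    have "a + b \<in> ?S" using that by blast
    with h(2) have "h \<le> dist e (a + b)" by (rule bspec)
    then show ?thesis by (simp add: dist_real_def abs_minus_commute)
  qed
  have none: False
    if "gap A p q" "0 \<le> p" "gap B r s" "0 \<le> r" "linked e p q r s"
      "T * (q - p) + T' * (s - r) < real n * h" for n p q r s
    using that
  proof (induction n arbitrary: p q r s)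
    case 0
    then show ?case using T by (auto simp: gap_def) (smt (verit) mult_pos_pos)
  next
    case (Suc n)
    have pq: "p < q" "r < s" using Suc.prems by (auto simp: gap_def)
    consider "s - r < T * (q - p)" | "q - p < T' * (s - r)"
    proof (rule ccontr)
      assume "\<not> thesis"
      then have *: "T * (q - p) \<le> s - r" "T' * (s - r) \<le> q - p" using that by force+
      have "T * (T' * (s - r)) \<le> s - r" using * T by (smt (verit) mult_left_mono)
      then have "(T * T') * (s - r) \<le> 1 * (s - r)" by (simp add: mult.assoc)
      then show False using T(3) pq by (metis diff_gt_0_iff_gt linorder_not_le mult_strict_right_mono)
    qed
    then show ?case
    proof cases
      case 1
      obtain p' q' where "gap A p' q'" "0 \<le> p'" "linked e p' q' r s"
        "T * (q' - p') \<le> T * (q - p) - h"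
        using smaller_linked_gap[OF A T(1) e(2) Suc.prems(1-5) sep h(1) 1] by blast
      then show False
        using Suc.IH[of p' q' r s] Suc.prems by (auto simp: algebra_simps)
    next
      case 2
      have sep': "h \<le> \<bar>b + a - e\<bar>" if "b \<in> B" "a \<in> A" for a b
        using sep[OF that(2,1)] by (simp add: add.commute)
      have "linked e r s p q" using Suc.prems by (simp add: linked_sym)
      then obtain r' s' where "gap B r' s'" "0 \<le> r'" "linked e r' s' p q"
        "T' * (s' - r') \<le> T' * (s - r) - h"
        using smaller_linked_gap[OF B T(2) e(3) Suc.prems(3,4,1,2) _ sep' h(1) 2] by blast
      moreover have "linked e p q r' s'" using calculation by (simp add: linked_sym)
      ultimately show False
        using Suc.IH[of p q r' s'] Suc.prems by (auto simp: algebra_simps)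
    qed
  qed
  obtain z z' where z: "z \<in> A" "d \<le> z" "z' \<in> B" "d' \<le> z'"
    using A B by (auto simp: one_sided_thick_def)
  have "e \<notin> B" using ne[of 0 e] cA by auto
  then obtain r s where V: "gap B r s" "0 \<le> r" "r < e" "e < s"
    using gap_around[OF cB(1), of e 0 z'] z e cB by auto
  have "e - r \<notin> A" using ne[of "e - r" r] V by (auto simp: gap_def)
  then obtain p q where U: "gap A p q" "0 \<le> p" "p < e - r" "e - r < q"
    using gap_around[OF cA(1), of "e - r" 0 z] z e cA V by auto
  have "linked e p q r s" using U V by (auto simp: linked_def)
  moreover obtain n where "T * (q - p) + T' * (s - r) < real n * h"
    using reals_Archimedean3[OF h(1)] by blast
  ultimately show False using none U V by blast
qed

section \<open>Squaring near an endpoint of a gap\<close>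

text \<open>On \<open>[b, b + k]\<close> the map has slope between \<open>2 * (b - x)\<close> and \<open>2 * (b - x + k)\<close>, so it changes the
ratio of a distance to the length of a gap by at most the factor \<open>1 + k / (b - x)\<close>, which is
at most \<open>T / T'\<close> for the chosen \<open>k\<close>. Points to the left of \<open>b\<close> are dropped because the map is
monotone only to the right of \<open>x\<close>. The scale \<open>d\<close> has to serve all \<open>x\<close> near \<open>\<xi>\<close>, hence the
bound \<open>m\<close> for \<open>b - x\<close>, which is independent of \<open>x\<close>.\<close>
lemma one_sided_thick_square_image:
  assumes K: "compact K" and gb: "gap K a b" and xi: "\<xi> < b" and T: "0 < T" "0 < T'" "T' < T"
    and right: "\<exists>z\<in>K. b + T * (b - a) \<le> z"
    and pair: "\<And>p q p' q'. gap K p q \<Longrightarrow> gap K p' q' \<Longrightarrow> q \<le> p' \<Longrightarrow> T * min (q - p) (q' - p') \<le> p' - q"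
  obtains d where "0 < d"
    "\<And>x. \<bar>x - \<xi>\<bar> < (b - \<xi>) / 2 \<Longrightarrow>
       one_sided_thick T' d ((\<lambda>y. (y - x)\<^sup>2 - (b - x)\<^sup>2) ` (K \<inter> {b..}))"
proof -
  define m where "m = (b - \<xi>) / 2"
  have m: "0 < m" using xi by (simp add: m_def)
  define k where "k = (T / T' - 1) * m"
  have k: "0 < k" using T m by (simp add: k_def)
  \<comment> \<open>The first bound keeps the compared gaps shorter than \<open>(a, b)\<close>, so that thickness
      controls them; the second keeps their right endpoints below \<open>b + k\<close>.\<close>
  define c where "c = min (T * (b - a)) (k * T / (1 + T))"
  have ab: "a < b" "a \<in> K" "b \<in> K" using gb by (auto simp: gap_def)
  have c: "0 < c" using T k ab by (simp add: c_def)
  have "one_sided_thick T' (2 * m * c) ((\<lambda>y. (y - x)\<^sup>2 - (b - x)\<^sup>2) ` (K \<inter> {b..}))"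
    if x: "\<bar>x - \<xi>\<bar> < (b - \<xi>) / 2" for x
  proof -
    let ?f = "\<lambda>y::real. (y - x)\<^sup>2 - (b - x)\<^sup>2"
    let ?L = "K \<inter> {b..}"
    have mx: "m < b - x" using x unfolding m_def by (simp add: abs_if field_simps split: if_splits)
    have diff: "?f z - ?f y = (z - y) * (z + y - 2 * x)" for y z
      by (simp add: power2_eq_square algebra_simps)
    have fb: "?f b = 0" by simp
    have mono: "?f y < ?f z" if "b \<le> y" "y < z" for y z
    proof -
      have "0 < (z - y) * (z + y - 2 * x)" using that mx m by (intro mult_pos_pos) auto
      then show ?thesis using diff[of z y] by linarith
    qed
    have le_iff: "?f y \<le> ?f z \<longleftrightarrow> y \<le> z" if "b \<le> y" "b \<le> z" for y z
      using mono[of y z] mono[of z y] that by (metis linorder_not_less order_less_le)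
    have lower: "2 * (b - x) * (z - y) \<le> ?f z - ?f y" if "b \<le> y" "y \<le> z" for y z
    proof -
      have "(z - y) * (2 * (b - x)) \<le> (z - y) * (z + y - 2 * x)"
        using that by (intro mult_left_mono) auto
      then show ?thesis using diff[of z y] by (simp add: mult.commute)
    qed
    have upper: "T' * (?f z - ?f y) \<le> 2 * (b - x) * (T * (z - y))"
      if "b \<le> y" "y \<le> z" "z \<le> b + k" for y z
    proof -
      have "T' * k = (T - T') * m" using T by (simp add: k_def field_simps)
      also have "\<dots> \<le> (T - T') * (b - x)" using T mx by (intro mult_left_mono) auto
      finally have kk: "T' * (b - x + k) \<le> T * (b - x)" by (simp add: algebra_simps)
      have "T' * (z + y - 2 * x) \<le> T' * (2 * (b - x + k))"
        using that k T by (intro mult_left_mono) auto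
      then have "T' * (z + y - 2 * x) \<le> 2 * (b - x) * T" using kk by (simp add: algebra_simps)
      then have "(z - y) * (T' * (z + y - 2 * x)) \<le> (z - y) * (2 * (b - x) * T)"
        using that by (intro mult_left_mono) auto
      then show ?thesis unfolding diff by (simp add: algebra_simps)
    qed
    have gapD: "\<exists>p q. P = ?f p \<and> Q = ?f q \<and> gap K p q \<and> b \<le> p" if "gap (?f ` ?L) P Q" for P Q
    proof -
      from that obtain p q where pq: "p \<in> ?L" "q \<in> ?L" "P = ?f p" "Q = ?f q" "?f p < ?f q"
        "{?f p<..<?f q} \<inter> ?f ` ?L = {}" by (auto simp: gap_def)
      then have "p < q" using le_iff[of q p] by force
      moreover have "y \<notin> K" if "p < y" "y < q" for y
      proof
        assume "y \<in> K"
        then have "y \<in> ?L" using that pq by auto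
        then have "?f y \<in> ?f ` ?L" by (rule imageI)
        moreover have "?f y \<in> {?f p<..<?f q}" using mono[of p y] mono[of y q] that pq by auto
        ultimately show False using pq(6) by blast
      qed
      ultimately have "gap K p q" using pq by (auto simp: gap_def)
      then show ?thesis using pq by blast
    qed
    have near: "p - b < c" if "b \<le> p" "?f p < 2 * m * c" for p
    proof -
      have "2 * m * (p - b) \<le> 2 * (b - x) * (p - b)"
        using mx that by (intro mult_right_mono) auto
      also have "\<dots> \<le> ?f p" using lower[of b p] that by simp
      finally have "2 * m * (p - b) < 2 * m * c" using that by linarith
      then show ?thesis using m by simp
    qed
    have close: "T * (q - p) \<le> p - b \<and> q \<le> b + k" if "gap K p q" "b \<le> p" "p - b < c" for p q
    proof -
      have *: "T * min (b - a) (q - p) \<le> p - b" using pair[OF gb that(1,2)] .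
      have "p - b < T * (b - a)" using that by (auto simp: c_def)
      then have 1: "T * (q - p) \<le> p - b" using * by (auto simp: min_def split: if_splits)
      have "T * (q - b) = T * (q - p) + T * (p - b)" by (simp add: algebra_simps)
      also have "\<dots> \<le> (1 + T) * (p - b)" using 1 by (simp add: algebra_simps)
      also have "\<dots> \<le> (1 + T) * (k * T / (1 + T))"
        using that T by (intro mult_left_mono) (auto simp: c_def)
      also have "\<dots> = T * k" using T by simp
      finally show ?thesis using 1 T by simp
    qed
    show ?thesis unfolding one_sided_thick_def
    proof (intro conjI allI impI)
      have "continuous_on ?L ?f" by (intro continuous_intros)
      then show "compact (?f ` ?L)"
        using K by (intro compact_continuous_image compact_Int_closed) auto
      have "?f b \<in> ?f ` ?L" using ab by (intro imageI) auto
      then show "0 \<in> ?f ` ?L" unfolding fb .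
      obtain z where z: "z \<in> K" "b + T * (b - a) \<le> z" using right by blast
      have pos: "0 < T * (b - a)" using T ab by simp
      have "2 * m * c \<le> 2 * (b - x) * (z - b)"
        using mx m c z by (intro mult_mono) (auto simp: c_def)
      also have "\<dots> \<le> ?f z" using lower[of b z] pos z by simp
      finally show "\<exists>w\<in>?f ` ?L. 2 * m * c \<le> w" using z pos by auto
    next
      fix P Q assume g: "gap (?f ` ?L) P Q" "0 \<le> P" "P < 2 * m * c"
      obtain p q where pq: "P = ?f p" "Q = ?f q" "gap K p q" "b \<le> p" using gapD[OF g(1)] by blast
      have "p < q" using pq by (auto simp: gap_def)
      have cl: "T * (q - p) \<le> p - b" "q \<le> b + k" using close pq near g by auto
      have "T' * (Q - P) \<le> 2 * (b - x) * (T * (q - p))"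
        using upper[of p q] pq cl \<open>p < q\<close> by auto
      also have "\<dots> \<le> 2 * (b - x) * (p - b)" using cl mx m by (intro mult_left_mono) auto
      also have "\<dots> \<le> P" using lower[of b p] pq by simp
      finally show "T' * (Q - P) \<le> P" .
    next
      fix P Q P' Q'
      assume g: "gap (?f ` ?L) P Q" "gap (?f ` ?L) P' Q'" "0 \<le> P" "Q \<le> P'" "P' < 2 * m * c"
      obtain p q where pq: "P = ?f p" "Q = ?f q" "gap K p q" "b \<le> p" using gapD[OF g(1)] by blast
      obtain p' q' where pq': "P' = ?f p'" "Q' = ?f q'" "gap K p' q'" "b \<le> p'"
        using gapD[OF g(2)] by blast
      have lt: "p < q" "p' < q'" using pq pq' by (auto simp: gap_def)
      have "q \<le> p'" using le_iff[of q p'] g pq pq' lt by auto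
      have n': "p' - b < c" using near pq' g by auto
      have cl: "q \<le> b + k" "q' \<le> b + k"
        using close pq pq' n' lt \<open>q \<le> p'\<close> by auto
      have "T' * min (Q - P) (Q' - P') = min (T' * (Q - P)) (T' * (Q' - P'))"
        using T by (simp add: min_def)
      also have "\<dots> \<le> min (2 * (b - x) * (T * (q - p))) (2 * (b - x) * (T * (q' - p')))"
        using upper[of p q] upper[of p' q'] pq pq' cl lt by (intro min.mono) auto
      also have "\<dots> = 2 * (b - x) * (T * min (q - p) (q' - p'))"
        using mx m T by (simp add: min_def)
      also have "\<dots> \<le> 2 * (b - x) * (p' - q)"
        using pair[OF pq(3) pq'(3) \<open>q \<le> p'\<close>] mx m by (intro mult_left_mono) auto
      also have "\<dots> \<le> P' - Q" using lower[of q p'] \<open>q \<le> p'\<close> pq pq' lt by simp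
      finally show "T' * min (Q - P) (Q' - P') \<le> P' - Q" .
    qed
  qed
  then show thesis using that[of "2 * m * c"] m c by auto
qed

section \<open>Dimension one\<close>

text \<open>In dimension one, \<open>y \<mapsto> y \<bullet> e\<close> is an isometry onto the real line for either choice of the unit
vector \<open>e\<close>. The facts below carry the bounded gaps and the unbounded gap over to the image. They
keep \<open>e\<close> arbitrary because its sign decides on which side of a point a given gap appears.\<close>
context
  fixes C :: "'a::euclidean_space set" and e :: 'a
  assumes C: "compact C" and e: "norm e = 1" and line: "\<And>y::'a. (y \<bullet> e) *\<^sub>R e = y"
begin

lemma line_inner_image: "y \<bullet> e \<in> (\<lambda>y. y \<bullet> e) ` C \<longleftrightarrow> y \<in> C"
  by (metis (no_types, lifting) imageE imageI line)

lemma line_inner_self: "e \<bullet> e = 1"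
  using e by (simp add: norm_eq_1)

lemma line_inner_scaleR: "(r *\<^sub>R e) \<bullet> e = r"
  by (simp add: line_inner_self)

lemma line_dist: "dist y z = \<bar>y \<bullet> e - z \<bullet> e\<bar>"
proof -
  have "norm (y - z) = norm (((y - z) \<bullet> e) *\<^sub>R e)" by (simp only: line)
  then show ?thesis using e by (simp add: dist_norm inner_diff_left)
qed

lemma line_bounded_gap:
  assumes "gap ((\<lambda>y. y \<bullet> e) ` C) p q"
  shows "{y. p < y \<bullet> e \<and> y \<bullet> e < q} \<in> bounded_gaps C" (is "?U \<in> _")
    and "q - p \<le> diameter {y. p < y \<bullet> e \<and> y \<bullet> e < q}"
    and "p *\<^sub>R e \<in> closure {y. p < y \<bullet> e \<and> y \<bullet> e < q}"
    and "q *\<^sub>R e \<in> closure {y. p < y \<bullet> e \<and> y \<bullet> e < q}"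
proof -
  let ?P = "\<lambda>w. path_component_set (- C) w"
  define w where "w = ((p + q) / 2) *\<^sub>R e"
  have pq: "p < q" "p \<in> (\<lambda>y. y \<bullet> e) ` C" "q \<in> (\<lambda>y. y \<bullet> e) ` C"
    and no: "\<And>r. p < r \<Longrightarrow> r < q \<Longrightarrow> r \<notin> (\<lambda>y. y \<bullet> e) ` C"
    using assms by (auto simp: gap_def)
  have we: "w \<bullet> e = (p + q) / 2" unfolding w_def by (rule line_inner_scaleR)
  have wU: "w \<in> ?U" using pq we by simp
  have U: "?U \<subseteq> - C"
  proof
    fix y assume "y \<in> ?U"
    then have "y \<bullet> e \<notin> (\<lambda>y. y \<bullet> e) ` C" using no[of "y \<bullet> e"] by blast
    then show "y \<in> - C" using line_inner_image by blast
  qed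
  have "?U = {y. e \<bullet> y > p} \<inter> {y. e \<bullet> y < q}" by (auto simp: inner_commute)
  then have "convex ?U" by (simp add: convex_Int convex_halfspace_lt convex_halfspace_gt)
  then have sub1: "?U \<subseteq> ?P w"
    using U wU by (intro path_component_maximal convex_imp_path_connected) auto
  have "connected (?P w)" by (intro path_connected_imp_connected path_connected_path_component)
  then have conn: "connected ((\<lambda>y. y \<bullet> e) ` ?P w)"
    by (intro connected_continuous_image continuous_intros)
  have disj: "r \<notin> (\<lambda>y. y \<bullet> e) ` ?P w" if "r \<in> (\<lambda>y. y \<bullet> e) ` C" for r
  proof
    assume "r \<in> (\<lambda>y. y \<bullet> e) ` ?P w"
    then obtain y where "y \<in> ?P w" "r = y \<bullet> e" by blast
    then show False using that path_component_subset[of "- C" w] line_inner_image[of y] by blast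
  qed
  have "w \<in> ?P w" using sub1 wU by blast
  then have wi: "(p + q) / 2 \<in> (\<lambda>y. y \<bullet> e) ` ?P w" using we by (metis imageI)
  have sub2: "z \<in> ?U" if "z \<in> ?P w" for z
  proof -
    have z: "z \<bullet> e \<in> (\<lambda>y. y \<bullet> e) ` ?P w" using that by (rule imageI)
    have "p < z \<bullet> e"
    proof (rule ccontr)
      assume "\<not> ?thesis"
      then show False using connectedD_interval[OF conn z wi, of p] disj pq by auto
    qed
    moreover have "z \<bullet> e < q"
    proof (rule ccontr)
      assume "\<not> ?thesis"
      then show False using connectedD_interval[OF conn wi z, of q] disj pq by auto
    qed
    ultimately show ?thesis by simp
  qed
  have "?U = ?P w" using sub1 sub2 by blast
  moreover have "w \<in> - C" using U wU by blast
  ultimately have "?U \<in> complement_components C" by (auto simp: complement_components_def)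
  moreover have bU: "bounded ?U"
  proof (rule boundedI)
    fix y assume "y \<in> ?U"
    then show "norm y \<le> \<bar>p\<bar> + \<bar>q\<bar>" using line_dist[of y 0] by auto
  qed
  ultimately show "?U \<in> bounded_gaps C" by (auto simp: bounded_gaps_def)
  have "(\<lambda>r. r *\<^sub>R e) ` closure {p<..<q} \<subseteq> closure ?U"
  proof (rule image_closure_subset)
    show "(\<lambda>r. r *\<^sub>R e) ` {p<..<q} \<subseteq> closure ?U"
      using closure_subset[of ?U] line_inner_self by fastforce
  qed (auto intro: continuous_intros)
  then show cl: "p *\<^sub>R e \<in> closure ?U" "q *\<^sub>R e \<in> closure ?U"
    using pq(1) by (auto simp: image_subset_iff)
  have "dist (p *\<^sub>R e) (q *\<^sub>R e) \<le> diameter (closure ?U)"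
    using bU cl by (intro diameter_bounded_bound) auto
  then show "q - p \<le> diameter ?U" using bU pq by (simp add: line_dist line_inner_self diameter_closure)
qed

lemma line_ray_unbounded_gap:
  assumes "\<And>y. y \<in> C \<Longrightarrow> y \<bullet> e \<le> z"
  shows "{y. z < y \<bullet> e} \<subseteq> unbounded_gap C" "z *\<^sub>R e \<in> closure (unbounded_gap C)"
proof -
  let ?R = "{y. z < y \<bullet> e}"
  have "?R = {y. e \<bullet> y > z}" by (auto simp: inner_commute)
  then have "convex ?R" by (simp add: convex_halfspace_gt)
  have R: "?R \<subseteq> - C" using assms by force
  have nb: "\<not> bounded ?R"
  proof
    assume "bounded ?R"
    then obtain B where B: "\<And>y. y \<in> ?R \<Longrightarrow> norm y \<le> B" by (auto simp: bounded_iff)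
    have "(\<bar>z\<bar> + \<bar>B\<bar> + 1) *\<^sub>R e \<in> ?R" using line_inner_self by auto
    from B[OF this] show False using e by simp
  qed
  show sub: "?R \<subseteq> unbounded_gap C"
  proof
    fix y assume y: "y \<in> ?R"
    then have *: "?R \<subseteq> path_component_set (- C) y"
      using R \<open>convex ?R\<close> by (intro path_component_maximal convex_imp_path_connected) auto
    then have "\<not> bounded (path_component_set (- C) y)" using nb bounded_subset by blast
    then show "y \<in> unbounded_gap C"
      using * y R unfolding unbounded_gap_def complement_components_def by blast
  qed
  have "(\<lambda>r. r *\<^sub>R e) ` closure {z<..} \<subseteq> closure (unbounded_gap C)"
  proof (rule image_closure_subset)
    show "(\<lambda>r. r *\<^sub>R e) ` {z<..} \<subseteq> closure (unbounded_gap C)"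
      using closure_subset[of "unbounded_gap C"] sub line_inner_self by fastforce
  qed (auto intro: continuous_intros)
  then show "z *\<^sub>R e \<in> closure (unbounded_gap C)" by auto
qed

end

text \<open>The coordinate is oriented so that some bounded gap \<open>(a, b)\<close> lies to the right of \<open>x\<close>; this is where
\<open>x \<in> C\<close> matters. Its right endpoint \<open>b\<close> gives the point \<open>c\<close>, at positive distance from \<open>x\<close>, and
beyond it the set is thick on one side. The conclusion mentions neither coordinate nor orientation,
so the two factors of a product can be oriented independently.\<close>
lemma one_sided_thick_distances:
  fixes C :: "'a::euclidean_space set"
  assumes dim: "DIM('a) = 1" and C: "compact C" "bounded_gaps C \<noteq> {}"
    and T: "ereal T \<le> thickness C" "0 < T'" "T' < T" and x: "x \<in> C"
  obtains c d r where "0 < d" "0 < r"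
    "\<And>z. z \<in> ball x r \<Longrightarrow> \<exists>A. one_sided_thick T' d A \<and>
        (\<forall>u\<in>A. \<exists>y\<in>C. (dist z y)\<^sup>2 = (dist z c)\<^sup>2 + u)"
proof -
  have T0: "0 < T" using T by simp
  obtain U where U: "U \<in> bounded_gaps C" using C by blast
  then obtain w where w: "U = path_component_set (- C) w" "w \<in> - C" "bounded U"
    by (auto simp: bounded_gaps_def complement_components_def)
  obtain e0 :: 'a where e0: "Basis = {e0}" using dim by (metis card_1_singletonE)
  have e0n: "norm e0 = 1" using e0 by (metis insertI1 norm_Basis)
  have e0l: "(y \<bullet> e0) *\<^sub>R e0 = y" for y :: 'a using euclidean_representation[of y] by (simp add: e0)
  have "w \<bullet> e0 \<noteq> x \<bullet> e0" using e0l x w by (metis ComplD)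
  moreover have "norm (- e0) = 1 \<and> (\<forall>y. (y \<bullet> (- e0)) *\<^sub>R (- e0) = y)" using e0n e0l by simp
  ultimately obtain e :: 'a where e: "norm e = 1" and line: "\<And>y. (y \<bullet> e) *\<^sub>R e = y"
    and xw: "x \<bullet> e < w \<bullet> e"
    using e0n e0l by (metis inner_minus_right linorder_neqE_linordered_idom neg_less_iff_less)
  note L = line_inner_image[OF C(1) e line] line_inner_self[OF C(1) e line]
    line_dist[OF C(1) e line]
  let ?K = "(\<lambda>y. y \<bullet> e) ` C"
  have cK: "compact ?K" using C by (intro compact_continuous_image continuous_intros) auto
  obtain m where m: "m \<in> ?K" "\<And>y. y \<in> ?K \<Longrightarrow> y \<le> m"
    using compact_attains_sup[OF cK] x by blast
  have ray: "{y. m < y \<bullet> e} \<subseteq> unbounded_gap C" "m *\<^sub>R e \<in> closure (unbounded_gap C)"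
    using line_ray_unbounded_gap[OF C(1) e line, of m] m by auto
  have wK: "w \<bullet> e \<notin> ?K" using w L by blast
  \<comment> \<open>Otherwise the bounded component of \<open>w\<close> would contain an unbounded ray.\<close>
  have "w \<bullet> e < m"
  proof (rule ccontr)
    assume "\<not> ?thesis"
    then have "m < w \<bullet> e" using m(1) wK by (metis linorder_neqE_linordered_idom)
    then have "w \<in> unbounded_gap C" using ray by blast
    then obtain v where v: "v \<in> - C" "w \<in> path_component_set (- C) v"
      "\<not> bounded (path_component_set (- C) v)"
      by (auto simp: unbounded_gap_def complement_components_def)
    then have "path_component_set (- C) v = U"
      using w by (metis mem_Collect_eq path_component_eq)
    then show False using w v by simp
  qed
  then obtain a b where ab: "gap ?K a b" "x \<bullet> e \<le> a" "a < w \<bullet> e" "w \<bullet> e < b"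
    using gap_around[OF cK wK imageI[OF x] xw m(1)] by blast
  note sep = bounded_gap_separation[OF C(1) T(1) T0]
  note slab = line_bounded_gap[OF C(1) e line]
  have right: "\<exists>z\<in>?K. b + T * (b - a) \<le> z"
  proof -
    have "T * (b - a) \<le> T * diameter {y. a < y \<bullet> e \<and> y \<bullet> e < b}"
      using slab(2)[OF ab(1)] T0 by simp
    also have "\<dots> \<le> dist (b *\<^sub>R e) (m *\<^sub>R e)"
      using sep(1)[OF slab(1)[OF ab(1)] ray(2) slab(4)[OF ab(1)]] .
    also have "\<dots> = m - b" using L(2,3) m(2)[of b] ab by (simp add: gap_def)
    finally show ?thesis using m by (intro bexI[of _ m]) auto
  qed
  have pair: "T * min (q - p) (q' - p') \<le> p' - q"
    if g: "gap ?K p q" "gap ?K p' q'" "q \<le> p'" for p q p' q'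
  proof -
    let ?U = "{y. p < y \<bullet> e \<and> y \<bullet> e < q}" and ?V = "{y. p' < y \<bullet> e \<and> y \<bullet> e < q'}"
    have "((p + q) / 2) *\<^sub>R e \<in> ?U" "((p + q) / 2) *\<^sub>R e \<notin> ?V"
      using g L(2) by (auto simp: gap_def)
    then have "?U \<noteq> ?V" by blast
    have "T * min (q - p) (q' - p') \<le> T * min (diameter ?U) (diameter ?V)"
      using slab(2) g T0 by (intro mult_left_mono min.mono) auto
    also have "\<dots> \<le> dist (q *\<^sub>R e) (p' *\<^sub>R e)"
      using sep(2)[OF slab(1)[OF g(1)] slab(1)[OF g(2)] \<open>?U \<noteq> ?V\<close> slab(4)[OF g(1)] slab(3)[OF g(2)]] .
    also have "\<dots> = p' - q" using L(2,3) g(3) by simp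
    finally show ?thesis .
  qed
  have xb: "x \<bullet> e < b" using ab by simp
  obtain d where d: "0 < d" "\<And>\<zeta>. \<bar>\<zeta> - x \<bullet> e\<bar> < (b - x \<bullet> e) / 2 \<Longrightarrow>
       one_sided_thick T' d ((\<lambda>y. (y - \<zeta>)\<^sup>2 - (b - \<zeta>)\<^sup>2) ` (?K \<inter> {b..}))"
    using one_sided_thick_square_image[OF cK ab(1) xb T0 T(2,3) right pair] by blast
  show thesis
  proof (rule that[of d "(b - x \<bullet> e) / 2" "b *\<^sub>R e"])
    fix z assume "z \<in> ball x ((b - x \<bullet> e) / 2)"
    then have "\<bar>z \<bullet> e - x \<bullet> e\<bar> < (b - x \<bullet> e) / 2"
      using L(3)[of x z] by (simp add: abs_minus_commute)
    note thick = d(2)[OF this]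
    have "\<exists>y\<in>C. (dist z y)\<^sup>2 = (dist z (b *\<^sub>R e))\<^sup>2 + u"
      if "u \<in> (\<lambda>y. (y - z \<bullet> e)\<^sup>2 - (b - z \<bullet> e)\<^sup>2) ` (?K \<inter> {b..})" for u
      using that by (auto simp: L(2,3) power2_commute)
    then show "\<exists>A. one_sided_thick T' d A \<and>
        (\<forall>u\<in>A. \<exists>y\<in>C. (dist z y)\<^sup>2 = (dist z (b *\<^sub>R e))\<^sup>2 + u)"
      using thick by blast
  qed (use d xb in auto)
qed

text \<open>The factor \<open>k\<close> leaves room for the thickness lost under squaring: the product of the reduced
thicknesses is the mean of 1 and \<open>T1 * T2\<close>. The base value \<open>(dist x c)\<^sup>2 + (dist x' c')\<^sup>2\<close> varies
continuously, so sums in a fixed interval slightly above its value at \<open>(a, b)\<close> exceed it by a small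
positive amount for all nearby pins.\<close>
lemma stable_square_sums_line:
  fixes A B :: "'a::euclidean_space set"
  assumes dim: "DIM('a) = 1" and A: "compact A" "bounded_gaps A \<noteq> {}" "a \<in> A"
    and B: "compact B" "bounded_gaps B \<noteq> {}" "b \<in> B"
    and T: "ereal T1 \<le> thickness A" "ereal T2 \<le> thickness B" "0 < T1" "0 < T2" "1 < T1 * T2"
  shows "stable_square_sums a A b B"
proof -
  define k where "k = sqrt ((1 + 1 / (T1 * T2)) / 2)"
  have k2: "k\<^sup>2 = (1 + 1 / (T1 * T2)) / 2" using T by (auto simp: k_def)
  have "k < sqrt 1" unfolding k_def using T by (intro real_sqrt_less_mono) auto
  then have k: "0 < k" "k < 1" using T by (auto simp: k_def intro!: add_pos_pos)
  have "(k * T1) * (k * T2) = k\<^sup>2 * (T1 * T2)" by (simp add: power2_eq_square)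
  also have "\<dots> = (T1 * T2 + 1) / 2" using T k2 by (simp add: field_simps)
  finally have prod: "1 < (k * T1) * (k * T2)" using T by simp
  have kT: "0 < k * T1" "k * T1 < T1" "0 < k * T2" "k * T2 < T2" using k T by auto
  obtain c d r where c: "0 < d" "0 < r"
    "\<And>z. z \<in> ball a r \<Longrightarrow> \<exists>P. one_sided_thick (k * T1) d P \<and>
        (\<forall>u\<in>P. \<exists>y\<in>A. (dist z y)\<^sup>2 = (dist z c)\<^sup>2 + u)"
    using one_sided_thick_distances[OF dim A(1,2) T(1) kT(1,2) A(3)] by metis
  obtain c' d' r' where c': "0 < d'" "0 < r'"
    "\<And>z. z \<in> ball b r' \<Longrightarrow> \<exists>P. one_sided_thick (k * T2) d' P \<and>
        (\<forall>u\<in>P. \<exists>y\<in>B. (dist z y)\<^sup>2 = (dist z c')\<^sup>2 + u)"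
    using one_sided_thick_distances[OF dim B(1,2) T(2) kT(3,4) B(3)] by metis
  define h where "h = min d d' / 4"
  have h: "0 < h" "4 * h \<le> d" "4 * h \<le> d'" using c c' by (auto simp: h_def)
  have "isCont (\<lambda>z. (dist z c)\<^sup>2) a" "isCont (\<lambda>z. (dist z c')\<^sup>2) b"
    by (intro continuous_intros)+
  then obtain g g' where g: "0 < g" "\<And>z. dist z a < g \<Longrightarrow> \<bar>(dist z c)\<^sup>2 - (dist a c)\<^sup>2\<bar> < h / 2"
    and g': "0 < g'" "\<And>z. dist z b < g' \<Longrightarrow> \<bar>(dist z c')\<^sup>2 - (dist b c')\<^sup>2\<bar> < h / 2"
    using h unfolding continuous_at_eps_delta dist_real_def by (metis half_gt_zero)
  define s where "s = (dist a c)\<^sup>2 + (dist b c')\<^sup>2 + h"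
  \<comment> \<open>Each base value moves by less than \<open>h / 2\<close>, so the excess \<open>e\<close> of \<open>u\<close> over
      their sum lies between 0 and \<open>3 * h\<close>.\<close>
  have "\<exists>y\<in>A. \<exists>y'\<in>B. (dist x y)\<^sup>2 + (dist x' y')\<^sup>2 = u"
    if x: "x \<in> ball a (min r g)" and x': "x' \<in> ball b (min r' g')" and u: "u \<in> {s<..<s + h}" for x x' u
  proof -
    define e where "e = u - (dist x c)\<^sup>2 - (dist x' c')\<^sup>2"
    have "\<bar>(dist x c)\<^sup>2 - (dist a c)\<^sup>2\<bar> < h / 2" "\<bar>(dist x' c')\<^sup>2 - (dist b c')\<^sup>2\<bar> < h / 2"
      using g(2)[of x] g'(2)[of x'] x x' by (auto simp: dist_commute)
    then have e: "0 < e" "e < d" "e < d'" using u h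
      unfolding e_def s_def abs_less_iff greaterThanLessThan_iff by linarith+
    obtain P where P: "one_sided_thick (k * T1) d P"
      "\<And>u. u \<in> P \<Longrightarrow> \<exists>y\<in>A. (dist x y)\<^sup>2 = (dist x c)\<^sup>2 + u" using c(3)[of x] x by auto
    obtain Q where Q: "one_sided_thick (k * T2) d' Q"
      "\<And>u. u \<in> Q \<Longrightarrow> \<exists>y\<in>B. (dist x' y)\<^sup>2 = (dist x' c')\<^sup>2 + u" using c'(3)[of x'] x' by auto
    obtain v v' where "v \<in> P" "v' \<in> Q" "v + v' = e"
      using one_sided_thick_sum[OF P(1) Q(1) kT(1,3) prod e] by blast
    moreover from this obtain y y' where "y \<in> A" "(dist x y)\<^sup>2 = (dist x c)\<^sup>2 + v"
      "y' \<in> B" "(dist x' y')\<^sup>2 = (dist x' c')\<^sup>2 + v'" using P Q by metis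
    ultimately show ?thesis by (intro bexI[of _ y] bexI[of _ y']) (auto simp: e_def)
  qed
  moreover have "0 \<le> s" "s < s + h" using h by (auto simp: s_def)
  ultimately show ?thesis unfolding stable_square_sums_def
    using c c' g(1) g'(1)
    by (intro exI[of _ "ball a (min r g)"] exI[of _ "ball b (min r' g')"] exI[of _ s] exI[of _ "s + h"]) auto
qed

section \<open>Pinned distances of products\<close>

theorem theorem1p8:
  fixes C1 C2 :: "'a::euclidean_space set" and x0 :: "'a \<times> 'a"
  assumes "compact C1" and "compact C2"
    and "thickness C1 * thickness C2 > 1"
    and "x0 \<in> C1 \<times> C2"
  shows "\<exists>S. open S \<and> x0 \<in> S \<and>
           interior (\<Inter>x\<in>S. pinned_distance_set x (C1 \<times> C2)) \<noteq> {}"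
proof -
  obtain a b where ab: "x0 = (a, b)" "a \<in> C1" "b \<in> C2" using assms(4) by auto
  have "thickness C1 \<noteq> 0" "thickness C2 \<noteq> 0" using assms(3) by auto
  then have pos: "0 < thickness C1" "0 < thickness C2" using thickness_nonneg by (auto simp: less_le)
  have gaps: "bounded_gaps C \<noteq> {}" if "interior C = {}" "0 < thickness C" for C :: "'a set"
    using that by (auto simp: thickness_def)
  consider "interior C1 \<noteq> {}" | "interior C2 \<noteq> {}" | "bounded_gaps C1 \<noteq> {}" "bounded_gaps C2 \<noteq> {}"
    using gaps pos by blast
  then have "stable_square_sums a C1 b C2"
  proof cases
    case 1
    then show ?thesis using stable_square_sums_interior ab by blast
  next
    case 2
    then show ?thesis using stable_square_sums_interior stable_square_sums_sym ab by blast
  next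
    case 3
    show ?thesis
    proof (cases "DIM('a) = 1")
      case True
      have finite_thickness: "\<exists>T. thickness C = ereal T"
        if "bounded_gaps C \<noteq> {}" "0 < thickness C" for C :: "'a set"
        using thickness_finite[OF that(1)] that(2) by (cases "thickness C") auto
      obtain T1 T2 where T: "thickness C1 = ereal T1" "thickness C2 = ereal T2"
        using finite_thickness 3 pos by blast
      then have "1 < T1 * T2" "0 < T1" "0 < T2" using assms(3) pos by (auto simp: one_ereal_def)
      with T show ?thesis
        using stable_square_sums_line[OF True assms(1) 3(1) ab(2) assms(2) 3(2) ab(3), of T1 T2] by simp
    next
      case False
      then have "2 \<le> DIM('a)" using DIM_positive[where 'a = 'a] by linarith
      then show ?thesis using stable_square_sums_higher_dim assms(1) 3 pos ab by blast
    qed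
  qed
  then show ?thesis unfolding ab(1) by (rule pinned_distances_of_stable_square_sums)
qed

end
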